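(* Let $f:X\to Y$ be a map between metric spaces, with metrically parallel fibers. Suppose that all fibers of $f$ are bilipschitz to ultrametric spaces, with bilipschitz constants independent of the fiber. Then $\dim(X)\le\dim(Y)$, where $\dim$ denotes covering dimension.
   Context: A map $f:X\to Y$ between metric spaces has metrically parallel fibers if for every $x,y\in X$ there exists $z\in X$ such that $d(x,z)=d(f(x),f(z))$ and $f(y)=f(z)$. The covering dimension of a topological space is the minimal $d$ such that every open covering has an open refinement with multiplicity at most $d+1$ (every point lies in at most $d+1$ members of the refinement). An ultrametric space is a metric space with $d(x,z)\le\max(d(x,y),d(y,z))$ for all $x,y,z$. The fibers of $f$ are the sets $f^{-1}(\{y\})$, endowed with the metric restricted from $X$.
   Formalization: The map f is assumed continuous; for arbitrary functions the claim is false (e.g. [0,1]×{0,1} with level distance |t−s|/10 and cross-level distance 1, projected to [0,1] with the discrete metric, has dimensions 1 > 0). *)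

theory Defs
  imports "HOL-Analysis.Abstract_Metric_Spaces" "HOL-Library.Extended_Real"
begin

definition open_cover_of :: "'a topology \<Rightarrow> 'a set set \<Rightarrow> bool" where
  "open_cover_of T \<U> \<longleftrightarrow> (\<forall>U\<in>\<U>. openin T U) \<and> \<Union>\<U> = topspace T"

definition refines :: "'a set set \<Rightarrow> 'a set set \<Rightarrow> bool" where
  "refines \<V> \<U> \<longleftrightarrow> (\<forall>V\<in>\<V>. \<exists>U\<in>\<U>. V \<subseteq> U)"

definition multiplicity_le :: "'a topology \<Rightarrow> 'a set set \<Rightarrow> nat \<Rightarrow> bool" where
  "multiplicity_le T \<V> n \<longleftrightarrow>
     (\<forall>x\<in>topspace T. finite {V\<in>\<V>. x \<in> V} \<and> card {V\<in>\<V>. x \<in> V} \<le> n)"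

text \<open>The minimal \<open>d \<in> {-1, 0, 1, \<dots>}\<close> is written as \<open>n - 1\<close> with \<open>n\<close> the bound on the
  multiplicity. Thus the empty space has dimension \<open>-1\<close>, and the dimension is \<open>\<infinity>\<close> (the infimum
  of the empty set) if no \<open>d\<close> works.\<close>

definition covering_dim :: "'a topology \<Rightarrow> ereal" where
  "covering_dim T =
     Inf {ereal (real n - 1) |n. \<forall>\<U>. open_cover_of T \<U> \<longrightarrow>
            (\<exists>\<V>. open_cover_of T \<V> \<and> refines \<V> \<U> \<and> multiplicity_le T \<V> n)}"

definition metrically_parallel_fibers ::
    "'a metric \<Rightarrow> 'b metric \<Rightarrow> ('a \<Rightarrow> 'b) \<Rightarrow> bool" where
  "metrically_parallel_fibers X Y f \<longleftrightarrow>
     (\<forall>x\<in>mspace X. \<forall>y\<in>mspace X. \<exists>z\<in>mspace X.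
        mdist X x z = mdist Y (f x) (f z) \<and> f y = f z)"

definition fiber :: "'a metric \<Rightarrow> ('a \<Rightarrow> 'b) \<Rightarrow> 'b \<Rightarrow> 'a metric" where
  "fiber X f y = submetric X {x \<in> mspace X. f x = y}"

definition ultrametric :: "'a metric \<Rightarrow> bool" where
  "ultrametric U \<longleftrightarrow>
     (\<forall>x\<in>mspace U. \<forall>y\<in>mspace U. \<forall>z\<in>mspace U.
        mdist U x z \<le> max (mdist U x y) (mdist U y z))"

definition bilipschitz_bijection ::
    "real \<Rightarrow> 'a metric \<Rightarrow> 'b metric \<Rightarrow> ('a \<Rightarrow> 'b) \<Rightarrow> bool" where
  "bilipschitz_bijection L M N g \<longleftrightarrow>
     L \<ge> 1 \<and> bij_betw g (mspace M) (mspace N) \<and>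
     (\<forall>x\<in>mspace M. \<forall>y\<in>mspace M.
        mdist M x y / L \<le> mdist N (g x) (g y) \<and> mdist N (g x) (g y) \<le> L * mdist M x y)"

end

theory Submission imports Defs begin

text \<open>Fix \<open>N\<close> such that every open cover of \<open>Y\<close> has an open refinement of multiplicity at most
  \<open>N\<close>; the task is to transfer this to \<open>X\<close>.

  Geometry enters through one estimate (\<open>chain_in_preimage_diameter\<close>). Let \<open>V\<close> lie in an
  \<open>\<epsilon>\<close>-ball of \<open>Y\<close>, and take a chain in the preimage of \<open>V\<close> with steps shorter than \<open>\<epsilon>\<close>. Since
  the fibers are metrically parallel, each point of the chain can be moved by less than \<open>2\<epsilon>\<close> into
  one fixed fiber, where the steps are still shorter than \<open>5\<epsilon>\<close>. In an ultrametric space the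
  endpoints of a chain are no further apart than its longest step, so the endpoints of the original
  chain are within \<open>K\<epsilon>\<close> of each other, with \<open>K\<close> depending only on the bilipschitz constant. Hence
  the preimage of \<open>V\<close> splits into disjoint open pieces, the classes of points joined by
  \<open>\<epsilon>\<close>-chains, of diameter at most \<open>K\<epsilon>\<close>. Replacing the members of a cover of \<open>Y\<close> by these pieces
  gives a cover of \<open>X\<close> of no larger multiplicity.

  Iterating refinement in \<open>Y\<close> with \<open>\<epsilon> \<rightarrow> 0\<close> yields a sequence of open covers of \<open>X\<close> of multiplicity
  at most \<open>N\<close>, each refining the one before, with mesh tending to \<open>0\<close>. Small mesh alone would not
  bound the covering dimension, but together with the successive refinement it does: a given open
  cover of \<open>X\<close> has a refinement glued from members of all the covers of the sequence
  (\<open>multiplicity_refinement_from_sequence\<close>).\<close>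

section \<open>Refinements of bounded multiplicity\<close>

definition has_refinements_of_multiplicity :: "'a topology \<Rightarrow> nat \<Rightarrow> bool" where
  "has_refinements_of_multiplicity T N \<longleftrightarrow>
     (\<forall>\<U>. open_cover_of T \<U> \<longrightarrow>
        (\<exists>\<V>. open_cover_of T \<V> \<and> refines \<V> \<U> \<and> multiplicity_le T \<V> N))"

lemma covering_dim_mono:
  assumes "\<And>N. has_refinements_of_multiplicity S N \<Longrightarrow> has_refinements_of_multiplicity T N"
  shows "covering_dim T \<le> covering_dim S"
  unfolding covering_dim_def
  using assms unfolding has_refinements_of_multiplicity_def
  by (intro Inf_superset_mono) blast

lemma refines_trans: "refines \<W> \<V> \<Longrightarrow> refines \<V> \<U> \<Longrightarrow> refines \<W> \<U>"
  unfolding refines_def by (meson subset_trans)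

lemma has_refinements_of_multiplicity_common:
  assumes "has_refinements_of_multiplicity T N" "open_cover_of T \<U>" "open_cover_of T \<U>'"
  obtains \<V> where "open_cover_of T \<V>" "multiplicity_le T \<V> N" "refines \<V> \<U>" "refines \<V> \<U>'"
proof -
  let ?\<I> = "{A \<inter> B |A B. A \<in> \<U> \<and> B \<in> \<U>'}"
  have "\<Union>?\<I> = \<Union>\<U> \<inter> \<Union>\<U>'" by blast
  then have "open_cover_of T ?\<I>"
    using assms(2,3) by (auto simp: open_cover_of_def)
  then obtain \<V> where \<V>: "open_cover_of T \<V>" "refines \<V> ?\<I>" "multiplicity_le T \<V> N"
    using assms(1) unfolding has_refinements_of_multiplicity_def by blast
  moreover have "refines ?\<I> \<U>" "refines ?\<I> \<U>'" by (auto simp: refines_def)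
  ultimately show thesis using that refines_trans by blast
qed

section \<open>Gluing a sequence of successively refining covers\<close>

text \<open>The oldest ancestor of \<open>V\<close>, a set of level \<open>m\<close>, that is reached through good sets only, where
  \<open>p k\<close> assigns to a set of level \<open>Suc k\<close> its parent of level \<open>k\<close>. The level is kept in
  the result because one set may occur on several levels.\<close>

fun oldest_good_ancestor ::
    "(nat \<Rightarrow> 'a set \<Rightarrow> 'a set) \<Rightarrow> ('a set \<Rightarrow> bool) \<Rightarrow> nat \<Rightarrow> 'a set \<Rightarrow> nat \<times> 'a set" where
  "oldest_good_ancestor p G 0 V = (0, V)"
| "oldest_good_ancestor p G (Suc m) V =
     (if G (p m V) then oldest_good_ancestor p G m (p m V) else (Suc m, V))"

text \<open>Call a set good if it is contained in a member of \<open>\<U>\<close>, and let \<open>R m\<close> be the largest open set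
  met only by good members of \<open>W m\<close>. Each good member \<open>V\<close> of \<open>W m\<close> contributes its
  part \<open>V \<inter> R m\<close> to the set \<open>H w\<close> named after its oldest good ancestor \<open>w\<close>; the nonempty
  \<open>H w\<close> form the refinement. To bound the multiplicity at \<open>x\<close>, take the least \<open>a\<close> with \<open>x \<in> R a\<close>.
  Contributions containing \<open>x\<close> come from levels \<open>m \<ge> a\<close> only, and the ancestors on the levels from
  \<open>a\<close> to \<open>m\<close> are all good, because the one on level \<open>a\<close> meets \<open>R a\<close> and contains the others. So \<open>w\<close> is the oldest good ancestor of a member of
  \<open>W a\<close> containing \<open>x\<close>, and there are at most \<open>N\<close> of those.\<close>

lemma multiplicity_refinement_from_sequence:
  fixes W :: "nat \<Rightarrow> 'a set set"
  assumes cover: "\<And>m. open_cover_of T (W m)"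
    and mult: "\<And>m. multiplicity_le T (W m) N"
    and refine: "\<And>m. refines (W (Suc m)) (W m)"
    and fine: "\<And>x. x \<in> topspace T \<Longrightarrow> \<exists>m Q. openin T Q \<and> x \<in> Q \<and>
                 (\<forall>V\<in>W m. V \<inter> Q \<noteq> {} \<longrightarrow> (\<exists>U\<in>\<U>. V \<subseteq> U))"
  shows "\<exists>\<V>. open_cover_of T \<V> \<and> refines \<V> \<U> \<and> multiplicity_le T \<V> N"
proof -
  define G where "G V \<longleftrightarrow> (\<exists>U\<in>\<U>. V \<subseteq> U)" for V
  have "\<forall>m V. \<exists>V'. V \<in> W (Suc m) \<longrightarrow> V' \<in> W m \<and> V \<subseteq> V'"
    using refine unfolding refines_def by blast
  then obtain p where p: "\<And>m V. V \<in> W (Suc m) \<Longrightarrow> p m V \<in> W m \<and> V \<subseteq> p m V"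
    by metis
  define anc where "anc = oldest_good_ancestor p G"
  have anc_sup: "V \<subseteq> snd (anc m V)" if "V \<in> W m" for m V
    using that unfolding anc_def
  proof (induction m arbitrary: V)
    case (Suc m)
    then show ?case using p[OF Suc.prems] by fastforce
  qed simp
  have anc_good: "G (snd (anc m V))" if "G V" for m V
    using that unfolding anc_def by (induction m arbitrary: V) auto
  define R where "R m = \<Union>{Q. openin T Q \<and> (\<forall>V\<in>W m. V \<inter> Q \<noteq> {} \<longrightarrow> G V)}" for m
  have R_open: "openin T (R m)" for m
    unfolding R_def by blast
  have R_good: "G V" if "V \<in> W m" "x \<in> V" "x \<in> R m" for V m x
    using that unfolding R_def by blast
  have R_cover: "\<exists>m. x \<in> R m" if "x \<in> topspace T" for x
    using fine[OF that] unfolding R_def G_def by blast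
  have W_open: "openin T V" if "V \<in> W m" for V m
    using cover that unfolding open_cover_of_def by blast
  have W_cover: "\<exists>V\<in>W m. x \<in> V" if "x \<in> topspace T" for x m
    using cover[of m] that unfolding open_cover_of_def by blast
  define H where "H w = \<Union>{V \<inter> R m |m V. V \<in> W m \<and> anc m V = w}" for w
  define \<V> where "\<V> = range H - {{}}"
  have in_H: "x \<in> H w \<longleftrightarrow> (\<exists>m V. V \<in> W m \<and> anc m V = w \<and> x \<in> V \<and> x \<in> R m)" for x w
    unfolding H_def by blast
  have "openin T (H w)" for w
    unfolding H_def using W_open R_open by (intro openin_Union) auto
  moreover have "topspace T \<subseteq> \<Union>\<V>"
  proof
    fix x assume x: "x \<in> topspace T"
    then obtain m V where "x \<in> R m" "V \<in> W m" "x \<in> V"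
      using R_cover W_cover by meson
    then have "x \<in> H (anc m V)" unfolding in_H by blast
    then show "x \<in> \<Union>\<V>" unfolding \<V>_def by blast
  qed
  ultimately have open_cover: "open_cover_of T \<V>"
    unfolding open_cover_of_def \<V>_def by (auto dest: openin_subset)
  have "refines \<V> \<U>"
    unfolding refines_def
  proof
    fix A assume "A \<in> \<V>"
    then obtain w x where w: "A = H w" "x \<in> H w" unfolding \<V>_def by blast
    then have "G (snd w)"
      using in_H R_good anc_good by metis
    moreover have "H w \<subseteq> snd w"
    proof
      fix z assume "z \<in> H w"
      then obtain m V where "V \<in> W m" "anc m V = w" "z \<in> V" unfolding in_H by blast
      then show "z \<in> snd w" using anc_sup by blast
    qed
    ultimately show "\<exists>U\<in>\<U>. A \<subseteq> U" unfolding G_def w(1) by blast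
  qed
  moreover have "finite {A \<in> \<V>. x \<in> A} \<and> card {A \<in> \<V>. x \<in> A} \<le> N" if x: "x \<in> topspace T" for x
  proof -
    define a where "a = (LEAST a. x \<in> R a)"
    have a: "x \<in> R a" and a_least: "\<And>m. x \<in> R m \<Longrightarrow> a \<le> m"
      unfolding a_def using R_cover[OF x] by (auto intro: LeastI_ex Least_le)
    have good_later: "G V" if "V \<in> W m" "x \<in> V" "a \<le> m" for V m
    proof -
      have "\<exists>V'\<in>W a. V \<subseteq> V'"
        using that(3,1)
      proof (induction m arbitrary: V rule: dec_induct)
        case (step k)
        then show ?case using p[OF step.prems] step.IH[of "p k V"] by blast
      qed blast
      then obtain V' where V': "V' \<in> W a" "V \<subseteq> V'" by blast
      then have "G V'" using R_good[OF V'(1) _ a] that(2) by blast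
      then show ?thesis using V'(2) unfolding G_def by blast
    qed
    have descend: "\<exists>V'\<in>W a. x \<in> V' \<and> anc a V' = anc m V"
      if "V \<in> W m" "x \<in> V" "a \<le> m" for V m
      using that(3,1,2)
    proof (induction m arbitrary: V rule: dec_induct)
      case (step k)
      have parent: "p k V \<in> W k" "x \<in> p k V"
        using p[OF step.prems(1)] step.prems(2) by auto
      then have "anc (Suc k) V = anc k (p k V)"
        using good_later step.hyps(1) unfolding anc_def by simp
      then show ?case using step.IH[OF parent] by simp
    qed blast
    let ?Wx = "{V \<in> W a. x \<in> V}"
    have Wx: "finite ?Wx" "card ?Wx \<le> N"
      using mult x unfolding multiplicity_le_def by auto
    have sub: "{A \<in> \<V>. x \<in> A} \<subseteq> (\<lambda>V. H (anc a V)) ` ?Wx"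
    proof
      fix A assume "A \<in> {A \<in> \<V>. x \<in> A}"
      then obtain w where w: "A = H w" "x \<in> H w" unfolding \<V>_def by blast
      then obtain m V where V: "V \<in> W m" "anc m V = w" "x \<in> V" "x \<in> R m"
        unfolding in_H by blast
      obtain V' where V': "V' \<in> ?Wx" "anc a V' = anc m V"
        using descend[OF V(1,3) a_least[OF V(4)]] by blast
      then have "A = H (anc a V')" using w(1) V(2) by simp
      then show "A \<in> (\<lambda>V. H (anc a V)) ` ?Wx" using V'(1) by (rule image_eqI)
    qed
    then show ?thesis
      using Wx surj_card_le[OF Wx(1) sub] finite_surj[OF Wx(1) sub] by simp
  qed
  ultimately show ?thesis
    using open_cover unfolding multiplicity_le_def by blast
qed

lemma openin_mball_of: "openin (mtopology_of X) (mball_of X x r)"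
  unfolding mtopology_of_def mball_of_def
  using Metric_space.openin_mball[OF Metric_space_mspace_mdist] .

lemma centre_in_mball_of: "x \<in> mspace X \<Longrightarrow> r > 0 \<Longrightarrow> x \<in> mball_of X x r"
  unfolding mball_of_def Metric_space.centre_in_mball_iff[OF Metric_space_mspace_mdist] by blast

text \<open>In a metric space, mesh tending to \<open>0\<close> provides the neighbourhoods that the gluing needs, for
  every open cover at once.\<close>

lemma has_refinements_of_multiplicity_if_mesh_tends_to_0:
  fixes X :: "'a metric" and W :: "nat \<Rightarrow> 'a set set"
  assumes cover: "\<And>m. open_cover_of (mtopology_of X) (W m)"
    and mult: "\<And>m. multiplicity_le (mtopology_of X) (W m) N"
    and refine: "\<And>m. refines (W (Suc m)) (W m)"
    and mesh: "\<And>m V u v. V \<in> W m \<Longrightarrow> u \<in> V \<Longrightarrow> v \<in> V \<Longrightarrow> mdist X u v \<le> \<delta> m"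
    and \<delta>: "\<delta> \<longlonglongrightarrow> 0"
  shows "has_refinements_of_multiplicity (mtopology_of X) N"
  unfolding has_refinements_of_multiplicity_def
proof (intro allI impI multiplicity_refinement_from_sequence[where W = W] cover mult refine)
  fix \<U> x assume \<U>: "open_cover_of (mtopology_of X) \<U>" and "x \<in> topspace (mtopology_of X)"
  then have x: "x \<in> mspace X" by simp
  obtain U where U: "U \<in> \<U>" "x \<in> U" "openin (mtopology_of X) U"
    using \<U> x unfolding open_cover_of_def by auto
  then obtain r where r: "r > 0" "mball_of X x r \<subseteq> U"
    unfolding mtopology_of_def mball_of_def
    using Metric_space.openin_mtopology[OF Metric_space_mspace_mdist] by metis
  have "\<forall>\<^sub>F m in sequentially. \<delta> m < r / 2"
    using order_tendstoD(2)[OF \<delta> half_gt_zero[OF r(1)]] .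
  then obtain m where m: "\<delta> m < r / 2"
    using eventually_sequentially by auto
  let ?B = "mball_of X x (r / 2)"
  have "V \<subseteq> U" if V: "V \<in> W m" "V \<inter> ?B \<noteq> {}" for V
  proof
    fix v assume v: "v \<in> V"
    obtain u where u: "u \<in> V" "u \<in> ?B" using V by blast
    have vX: "v \<in> mspace X"
      using cover[of m] V(1) v unfolding open_cover_of_def by auto
    have "mdist X x v \<le> mdist X x u + mdist X u v"
      using mdist_triangle x u(2) vX by auto
    also have "\<dots> < r"
      using mesh[OF V(1) u(1) v] u(2) m by auto
    finally show "v \<in> U" using r(2) x vX by auto
  qed
  moreover have "openin (mtopology_of X) ?B" by (rule openin_mball_of)
  moreover have "x \<in> ?B" by (rule centre_in_mball_of[OF x half_gt_zero[OF r(1)]])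
  ultimately show "\<exists>m Q. openin (mtopology_of X) Q \<and> x \<in> Q \<and>
      (\<forall>V\<in>W m. V \<inter> Q \<noteq> {} \<longrightarrow> (\<exists>U\<in>\<U>. V \<subseteq> U))"
    using U(1) by blast
qed

section \<open>Chains in preimages of small sets\<close>

definition chain_step :: "'a metric \<Rightarrow> real \<Rightarrow> 'a set \<Rightarrow> ('a \<times> 'a) set" where
  "chain_step X \<epsilon> S = {(u, v). u \<in> S \<and> v \<in> S \<and> mdist X u v < \<epsilon>}"

definition chain_class :: "'a metric \<Rightarrow> real \<Rightarrow> 'a set \<Rightarrow> 'a \<Rightarrow> 'a set" where
  "chain_class X \<epsilon> S x = {z. (x, z) \<in> (chain_step X \<epsilon> S)\<^sup>*}"

lemma chain_class_refl: "x \<in> chain_class X \<epsilon> S x"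
  by (simp add: chain_class_def)

lemma chain_class_subset: "x \<in> S \<Longrightarrow> chain_class X \<epsilon> S x \<subseteq> S"
proof
  fix z assume "x \<in> S" and "z \<in> chain_class X \<epsilon> S x"
  then have "(x, z) \<in> (chain_step X \<epsilon> S)\<^sup>*" by (simp add: chain_class_def)
  then show "z \<in> S"
    using \<open>x \<in> S\<close> by (induction rule: rtrancl_induct) (auto simp: chain_step_def)
qed

lemma chain_class_mono:
  assumes "S \<subseteq> S'" "\<epsilon> \<le> \<epsilon>'"
  shows "chain_class X \<epsilon> S x \<subseteq> chain_class X \<epsilon>' S' x"
proof -
  have "chain_step X \<epsilon> S \<subseteq> chain_step X \<epsilon>' S'"
    using assms by (auto simp: chain_step_def)
  then show ?thesis
    unfolding chain_class_def using rtrancl_mono by blast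
qed

lemma chain_class_eq:
  assumes "z \<in> chain_class X \<epsilon> S x"
  shows "chain_class X \<epsilon> S z = chain_class X \<epsilon> S x"
proof -
  have "sym ((chain_step X \<epsilon> S)\<^sup>*)"
    by (intro sym_rtrancl) (auto simp: sym_def chain_step_def mdist_commute)
  then show ?thesis
    using assms unfolding chain_class_def by (auto dest: symD intro: rtrancl_trans)
qed

lemma openin_chain_class:
  assumes S: "openin (mtopology_of X) S" and "x \<in> S" "\<epsilon> > 0"
  shows "openin (mtopology_of X) (chain_class X \<epsilon> S x)"
proof -
  interpret Metric_space "mspace X" "mdist X" by blast
  have S': "S \<subseteq> mspace X" using openin_subset[OF S] by simp
  have "\<exists>r>0. mball z r \<subseteq> chain_class X \<epsilon> S x" if z: "z \<in> chain_class X \<epsilon> S x" for z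
  proof -
    have "z \<in> S" using chain_class_subset[OF assms(2)] z by blast
    then obtain r where r: "r > 0" "mball z r \<subseteq> S"
      using S unfolding mtopology_of_def openin_mtopology by blast
    have "mball z (min r \<epsilon>) \<subseteq> chain_class X \<epsilon> S x"
    proof
      fix v assume "v \<in> mball z (min r \<epsilon>)"
      then have "v \<in> S" "mdist X z v < \<epsilon>" using r(2) by auto
      then have "(z, v) \<in> chain_step X \<epsilon> S" using \<open>z \<in> S\<close> by (simp add: chain_step_def)
      then show "v \<in> chain_class X \<epsilon> S x"
        using z unfolding chain_class_def by (auto intro: rtrancl_into_rtrancl)
    qed
    then show ?thesis using r(1) assms(3) by (meson min_less_iff_conj)
  qed
  then show ?thesis
    unfolding mtopology_of_def openin_mtopology
    using chain_class_subset[OF assms(2)] S' by blast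
qed

text \<open>A chain is carried into the fiber \<open>F\<close> through its first point \<open>x\<close>: parallel fibers
  provide for each \<open>u\<close> a point \<open>\<pi> u\<close> of \<open>F\<close> within \<open>2\<epsilon>\<close>. In the ultrametric model of \<open>F\<close> the
  projected chain has steps of length at most \<open>5L\<epsilon>\<close>, so its endpoints are at most \<open>5L\<epsilon>\<close> apart;
  going back to \<open>F\<close> costs another factor \<open>L\<close>, and undoing the projection at both ends costs
  \<open>4\<epsilon>\<close>.\<close>

lemma chain_in_preimage_diameter:
  fixes X :: "'a metric" and Y :: "'b metric" and U :: "'c metric"
  assumes parallel: "metrically_parallel_fibers X Y f"
    and U: "ultrametric U" "bilipschitz_bijection L (fiber X f (f x)) U g"
    and S: "S \<subseteq> mspace X" "x \<in> S" "f ` S \<subseteq> mball_of Y c \<epsilon>"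
    and v: "v \<in> chain_class X \<epsilon> S x"
  shows "mdist X x v \<le> (5 * L\<^sup>2 + 4) * \<epsilon>"
proof -
  let ?F = "{z \<in> mspace X. f z = f x}"
  have F: "mspace (fiber X f (f x)) = ?F" "mdist (fiber X f (f x)) = mdist X"
    unfolding fiber_def by auto
  have L: "L \<ge> 1" and g_in: "\<And>z. z \<in> ?F \<Longrightarrow> g z \<in> mspace U"
    and g_lower: "\<And>y z. y \<in> ?F \<Longrightarrow> z \<in> ?F \<Longrightarrow> mdist X y z / L \<le> mdist U (g y) (g z)"
    and g_upper: "\<And>y z. y \<in> ?F \<Longrightarrow> z \<in> ?F \<Longrightarrow> mdist U (g y) (g z) \<le> L * mdist X y z"
    using U(2) unfolding bilipschitz_bijection_def F by (auto dest: bij_betwE)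
  have f_close: "mdist Y (f u) (f w) < 2 * \<epsilon>" if "u \<in> S" "w \<in> S" for u w
  proof -
    have "f u \<in> mball_of Y c \<epsilon>" "f w \<in> mball_of Y c \<epsilon>" using S(3) that by auto
    then show ?thesis
      using mdist_triangle[of "f u" Y c "f w"] mdist_commute[of Y c "f u"] by simp
  qed
  have "\<exists>z. z \<in> ?F \<and> mdist X u z < 2 * \<epsilon>" if u: "u \<in> S" for u
  proof -
    obtain z where "z \<in> mspace X" "mdist X u z = mdist Y (f u) (f z)" "f x = f z"
      using parallel u S(1,2) unfolding metrically_parallel_fibers_def by blast
    then show ?thesis using f_close[OF u S(2)] by auto
  qed
  then obtain \<pi> where \<pi>: "\<And>u. u \<in> S \<Longrightarrow> \<pi> u \<in> ?F" "\<And>u. u \<in> S \<Longrightarrow> mdist X u (\<pi> u) < 2 * \<epsilon>"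
    by metis
  have proj_step: "mdist X (\<pi> u) (\<pi> w) \<le> 5 * \<epsilon>" if "(u, w) \<in> chain_step X \<epsilon> S" for u w
  proof -
    have uw: "u \<in> S" "w \<in> S" "mdist X u w < \<epsilon>" using that by (auto simp: chain_step_def)
    then have sp: "u \<in> mspace X" "w \<in> mspace X" "\<pi> u \<in> mspace X" "\<pi> w \<in> mspace X"
      using S(1) \<pi>(1) by auto
    have "mdist X (\<pi> u) (\<pi> w) \<le> mdist X (\<pi> u) u + (mdist X u w + mdist X w (\<pi> w))"
      using mdist_triangle[OF sp(3,1,4)] mdist_triangle[OF sp(1,2,4)] by simp
    then show ?thesis
      using uw(3) \<pi>(2)[OF uw(1)] \<pi>(2)[OF uw(2)] mdist_commute[of X u "\<pi> u"] by simp
  qed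
  have \<epsilon>: "0 \<le> \<epsilon>"
    using f_close[OF S(2,2)] mdist_nonneg[of Y "f x" "f x"] by linarith
  have "(x, v) \<in> (chain_step X \<epsilon> S)\<^sup>*" using v by (simp add: chain_class_def)
  then have ultra: "mdist U (g (\<pi> x)) (g (\<pi> v)) \<le> L * (5 * \<epsilon>)"
  proof (induction rule: rtrancl_induct)
    case base
    have "mdist U (g (\<pi> x)) (g (\<pi> x)) = 0"
      using g_in[OF \<pi>(1)[OF S(2)]] by simp
    then show ?case using L \<epsilon> by simp
  next
    case (step u w)
    have uw: "u \<in> S" "w \<in> S" using step.hyps(2) by (auto simp: chain_step_def)
    have "mdist U (g (\<pi> u)) (g (\<pi> w)) \<le> L * mdist X (\<pi> u) (\<pi> w)"
      using g_upper \<pi>(1) uw by blast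
    also have "\<dots> \<le> L * (5 * \<epsilon>)"
      using proj_step[OF step.hyps(2)] L by (intro mult_left_mono) auto
    finally have "mdist U (g (\<pi> u)) (g (\<pi> w)) \<le> L * (5 * \<epsilon>)" .
    moreover have "mdist U (g (\<pi> x)) (g (\<pi> w))
        \<le> max (mdist U (g (\<pi> x)) (g (\<pi> u))) (mdist U (g (\<pi> u)) (g (\<pi> w)))"
      using U(1) g_in \<pi>(1) S(2) uw unfolding ultrametric_def by blast
    ultimately show ?case using step.IH by simp
  qed
  have vS: "v \<in> S" using chain_class_subset[OF S(2)] v by blast
  have "mdist X (\<pi> x) (\<pi> v) / L \<le> L * (5 * \<epsilon>)"
    using g_lower[OF \<pi>(1)[OF S(2)] \<pi>(1)[OF vS]] ultra by linarith
  then have in_F: "mdist X (\<pi> x) (\<pi> v) \<le> 5 * L\<^sup>2 * \<epsilon>"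
    using L by (simp add: field_simps power2_eq_square)
  have sp: "x \<in> mspace X" "v \<in> mspace X" "\<pi> x \<in> mspace X" "\<pi> v \<in> mspace X"
    using S(1,2) vS \<pi>(1) by auto
  have "mdist X x v \<le> mdist X x (\<pi> x) + (mdist X (\<pi> x) (\<pi> v) + mdist X (\<pi> v) v)"
    using mdist_triangle[OF sp(1,3,2)] mdist_triangle[OF sp(3,4,2)] by simp
  also have "\<dots> \<le> 2 * \<epsilon> + (5 * L\<^sup>2 * \<epsilon> + 2 * \<epsilon>)"
    using in_F \<pi>(2)[OF S(2)] \<pi>(2)[OF vS] mdist_commute[of X v "\<pi> v"] by simp
  finally show ?thesis by (simp add: algebra_simps)
qed

section \<open>Covers by pieces of preimages\<close>

definition preimage_pieces ::
    "'a metric \<Rightarrow> ('a \<Rightarrow> 'b) \<Rightarrow> real \<Rightarrow> 'b set set \<Rightarrow> 'a set set" where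
  "preimage_pieces X f \<epsilon> \<V> =
     {chain_class X \<epsilon> {u \<in> mspace X. f u \<in> V} x |V x. V \<in> \<V> \<and> x \<in> mspace X \<and> f x \<in> V}"

lemma open_cover_of_preimage_pieces:
  assumes f: "continuous_map (mtopology_of X) T f"
    and \<V>: "open_cover_of T \<V>" and "\<epsilon> > 0"
  shows "open_cover_of (mtopology_of X) (preimage_pieces X f \<epsilon> \<V>)"
proof -
  have "openin (mtopology_of X) {u \<in> mspace X. f u \<in> V}" if "V \<in> \<V>" for V
    using f \<V> that unfolding open_cover_of_def continuous_map_def by simp
  then have op: "openin (mtopology_of X) W" if "W \<in> preimage_pieces X f \<epsilon> \<V>" for W
    using that \<open>\<epsilon> > 0\<close> unfolding preimage_pieces_def by (auto intro: openin_chain_class)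
  have "x \<in> \<Union>(preimage_pieces X f \<epsilon> \<V>)" if x: "x \<in> mspace X" for x
  proof -
    have "f x \<in> topspace T" using f x unfolding continuous_map_def by auto
    then obtain V where "V \<in> \<V>" "f x \<in> V" using \<V> unfolding open_cover_of_def by blast
    then show ?thesis
      unfolding preimage_pieces_def using x chain_class_refl by fast
  qed
  then show ?thesis
    unfolding open_cover_of_def using op openin_subset by fastforce
qed

text \<open>The pieces of one preimage are disjoint, so a piece containing \<open>x\<close> is determined by a member of
  \<open>\<V>\<close> containing \<open>f x\<close>.\<close>

lemma multiplicity_le_preimage_pieces:
  assumes f: "f ` mspace X \<subseteq> topspace T" and \<V>: "multiplicity_le T \<V> N"
  shows "multiplicity_le (mtopology_of X) (preimage_pieces X f \<epsilon> \<V>) N"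
  unfolding multiplicity_le_def
proof
  fix x assume "x \<in> topspace (mtopology_of X)"
  then have "f x \<in> topspace T" using f by auto
  then have fin: "finite {V \<in> \<V>. f x \<in> V}" "card {V \<in> \<V>. f x \<in> V} \<le> N"
    using \<V> unfolding multiplicity_le_def by auto
  have sub: "{W \<in> preimage_pieces X f \<epsilon> \<V>. x \<in> W}
      \<subseteq> (\<lambda>V. chain_class X \<epsilon> {u \<in> mspace X. f u \<in> V} x) ` {V \<in> \<V>. f x \<in> V}"
  proof
    fix W assume "W \<in> {W \<in> preimage_pieces X f \<epsilon> \<V>. x \<in> W}"
    then obtain V x' where V: "V \<in> \<V>" "x' \<in> {u \<in> mspace X. f u \<in> V}"
      and W: "W = chain_class X \<epsilon> {u \<in> mspace X. f u \<in> V} x'" "x \<in> W"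
      unfolding preimage_pieces_def by blast
    have "f x \<in> V" using chain_class_subset[OF V(2)] W by blast
    moreover have "W = chain_class X \<epsilon> {u \<in> mspace X. f u \<in> V} x"
      using chain_class_eq W by metis
    ultimately show "W \<in> (\<lambda>V. chain_class X \<epsilon> {u \<in> mspace X. f u \<in> V} x) ` {V \<in> \<V>. f x \<in> V}"
      using V(1) by blast
  qed
  then show "finite {W \<in> preimage_pieces X f \<epsilon> \<V>. x \<in> W} \<and>
      card {W \<in> preimage_pieces X f \<epsilon> \<V>. x \<in> W} \<le> N"
    using fin surj_card_le[OF fin(1) sub] finite_surj[OF fin(1) sub] by simp
qed

lemma refines_preimage_pieces:
  assumes "refines \<V> \<V>'" "\<epsilon> \<le> \<epsilon>'"
  shows "refines (preimage_pieces X f \<epsilon> \<V>) (preimage_pieces X f \<epsilon>' \<V>')"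
  unfolding refines_def
proof
  fix W assume "W \<in> preimage_pieces X f \<epsilon> \<V>"
  then obtain V x where V: "V \<in> \<V>" "x \<in> mspace X" "f x \<in> V"
    and W: "W = chain_class X \<epsilon> {u \<in> mspace X. f u \<in> V} x"
    unfolding preimage_pieces_def by blast
  obtain V' where V': "V' \<in> \<V>'" "V \<subseteq> V'" using assms(1) V(1) unfolding refines_def by blast
  then have "W \<subseteq> chain_class X \<epsilon>' {u \<in> mspace X. f u \<in> V'} x"
    unfolding W using assms(2) by (intro chain_class_mono) auto
  moreover have "chain_class X \<epsilon>' {u \<in> mspace X. f u \<in> V'} x \<in> preimage_pieces X f \<epsilon>' \<V>'"
    unfolding preimage_pieces_def using V V' by blast
  ultimately show "\<exists>W'\<in>preimage_pieces X f \<epsilon>' \<V>'. W \<subseteq> W'" by blast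
qed

lemma mesh_preimage_pieces:
  fixes X :: "'a metric" and Y :: "'b metric" and f :: "'a \<Rightarrow> 'b"
  assumes f: "f ` mspace X \<subseteq> mspace Y"
    and parallel: "metrically_parallel_fibers X Y f"
    and fibers: "\<And>y. y \<in> mspace Y \<Longrightarrow> \<exists>(U :: 'c metric) g.
           ultrametric U \<and> bilipschitz_bijection L (fiber X f y) U g"
    and \<V>: "refines \<V> (range (\<lambda>c. mball_of Y c \<epsilon>))"
    and W: "W \<in> preimage_pieces X f \<epsilon> \<V>" "u \<in> W" "v \<in> W"
  shows "mdist X u v \<le> (5 * L\<^sup>2 + 4) * \<epsilon>"
proof -
  obtain V x where V: "V \<in> \<V>" "x \<in> {u \<in> mspace X. f u \<in> V}"
    and W_eq: "W = chain_class X \<epsilon> {u \<in> mspace X. f u \<in> V} x"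
    using W(1) unfolding preimage_pieces_def by blast
  let ?S = "{u \<in> mspace X. f u \<in> V}"
  have u: "u \<in> ?S" using chain_class_subset[OF V(2)] W(2) unfolding W_eq by blast
  have v: "v \<in> chain_class X \<epsilon> ?S u" using W(2,3) chain_class_eq unfolding W_eq by metis
  obtain c where c: "f ` ?S \<subseteq> mball_of Y c \<epsilon>" using \<V> V(1) unfolding refines_def by blast
  have "f u \<in> mspace Y" using f u by auto
  then obtain U :: "'c metric" and g
    where "ultrametric U" "bilipschitz_bijection L (fiber X f (f u)) U g"
    using fibers by blast
  from chain_in_preimage_diameter[OF parallel this _ u c v] show ?thesis by blast
qed

lemma open_cover_of_balls:
  assumes "\<epsilon> > 0"
  shows "open_cover_of (mtopology_of Y) (range (\<lambda>c. mball_of Y c \<epsilon>))"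
proof -
  have "mspace Y \<subseteq> (\<Union>c. mball_of Y c \<epsilon>)"
  proof
    fix y assume "y \<in> mspace Y"
    from centre_in_mball_of[OF this assms] show "y \<in> (\<Union>c. mball_of Y c \<epsilon>)"
      by (rule UN_I[OF UNIV_I])
  qed
  moreover have "(\<Union>c. mball_of Y c \<epsilon>) \<subseteq> mspace Y"
    by (rule UN_least) (simp add: subset_iff)
  ultimately show ?thesis
    by (simp add: open_cover_of_def openin_mball_of subset_antisym)
qed

lemma successively_refining_covers_by_small_sets:
  fixes Y :: "'b metric"
  assumes "has_refinements_of_multiplicity (mtopology_of Y) N" "\<And>m. \<epsilon> m > 0"
  shows "\<exists>\<V>. \<forall>m. (open_cover_of (mtopology_of Y) (\<V> m) \<and>
      multiplicity_le (mtopology_of Y) (\<V> m) N \<and>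
      refines (\<V> m) (range (\<lambda>c. mball_of Y c (\<epsilon> m)))) \<and> refines (\<V> (Suc m)) (\<V> m)"
proof -
  let ?P = "\<lambda>m \<V>. open_cover_of (mtopology_of Y) \<V> \<and> multiplicity_le (mtopology_of Y) \<V> N \<and>
      refines \<V> (range (\<lambda>c. mball_of Y c (\<epsilon> m)))"
  have step: "\<exists>\<V>. ?P m \<V> \<and> refines \<V> \<U>" if "open_cover_of (mtopology_of Y) \<U>" for m \<U>
    using has_refinements_of_multiplicity_common[OF assms(1) that open_cover_of_balls[OF assms(2)]]
    by metis
  show ?thesis
    using step step[OF open_cover_of_balls[OF assms(2)]] by (intro dependent_nat_choice) blast+
qed

section \<open>The dimension inequality\<close>

theorem theorem3p3:
  fixes X :: "'a metric" and Y :: "'b metric" and f :: "'a \<Rightarrow> 'b"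
  assumes "continuous_map (mtopology_of X) (mtopology_of Y) f"
    and "metrically_parallel_fibers X Y f"
    and "\<exists>L. \<forall>y\<in>mspace Y. \<exists>(U :: 'c metric) g.
           ultrametric U \<and> bilipschitz_bijection L (fiber X f y) U g"
  shows "covering_dim (mtopology_of X) \<le> covering_dim (mtopology_of Y)"
proof (rule covering_dim_mono)
  fix N assume N: "has_refinements_of_multiplicity (mtopology_of Y) N"
  obtain L where L: "\<And>y. y \<in> mspace Y \<Longrightarrow> \<exists>(U :: 'c metric) g.
           ultrametric U \<and> bilipschitz_bijection L (fiber X f y) U g"
    using assms(3) by blast
  have f: "f ` mspace X \<subseteq> mspace Y"
    using assms(1) unfolding continuous_map_def by auto
  define \<epsilon> where "\<epsilon> m = inverse (real (Suc m))" for m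
  have \<epsilon>: "\<epsilon> m > 0" "\<epsilon> (Suc m) \<le> \<epsilon> m" for m
    unfolding \<epsilon>_def by (auto simp: field_simps)
  obtain \<V> where \<V>: "\<And>m. open_cover_of (mtopology_of Y) (\<V> m)"
    "\<And>m. multiplicity_le (mtopology_of Y) (\<V> m) N"
    "\<And>m. refines (\<V> m) (range (\<lambda>c. mball_of Y c (\<epsilon> m)))"
    "\<And>m. refines (\<V> (Suc m)) (\<V> m)"
    using successively_refining_covers_by_small_sets[where \<epsilon> = \<epsilon>, OF N \<epsilon>(1)] by blast
  show "has_refinements_of_multiplicity (mtopology_of X) N"
  proof (rule has_refinements_of_multiplicity_if_mesh_tends_to_0)
    show "open_cover_of (mtopology_of X) (preimage_pieces X f (\<epsilon> m) (\<V> m))" for m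
      using open_cover_of_preimage_pieces[OF assms(1) \<V>(1) \<epsilon>(1)] .
    show "multiplicity_le (mtopology_of X) (preimage_pieces X f (\<epsilon> m) (\<V> m)) N" for m
      using multiplicity_le_preimage_pieces[OF _ \<V>(2)] f by simp
    show "refines (preimage_pieces X f (\<epsilon> (Suc m)) (\<V> (Suc m)))
        (preimage_pieces X f (\<epsilon> m) (\<V> m))" for m
      using refines_preimage_pieces[OF \<V>(4) \<epsilon>(2)] .
    show "mdist X u v \<le> (5 * L\<^sup>2 + 4) * \<epsilon> m"
      if "W \<in> preimage_pieces X f (\<epsilon> m) (\<V> m)" "u \<in> W" "v \<in> W" for m W u v
      using mesh_preimage_pieces[OF f assms(2) L \<V>(3) that] .
    show "(\<lambda>m. (5 * L\<^sup>2 + 4) * \<epsilon> m) \<longlonglongrightarrow> 0"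
      unfolding \<epsilon>_def using tendsto_mult_right_zero[OF LIMSEQ_inverse_real_of_nat] .
  qed
qed

end
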